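(* Let $\Delta=\mathrm{diag}(b_1,b_2,b_3)$ with $b_1,b_2,b_3$ distinct nonzero complex numbers. Let $\mathcal L$ be a subspace of $M_3[\mathbb C]$ with $\dim\mathcal L=5$ such that $\mathcal L_0=\mathcal L\cap\mathcal M_3$ is 2-dimensional. Assume that the canonical basis $(L_1,L_2)$ of $\mathcal L_0$ is of the form (E$n$) listed in the context, for some $n\in\{1,\dots,14\}$, $n\neq7$. If $\mathcal L$ is $\Delta$-singular, then $\mathcal L$ is not transitive.
   Context: $M_3[\mathbb C]$ is the space of $3\times3$ complex matrices and $\mathcal M_3$ its subspace of matrices whose third column is zero. $J=\begin{bmatrix}0&0&0\\ 1&0&0\\ 0&1&0\end{bmatrix}$. A subspace $\mathcal L$ is $\Delta$-singular if $\det(\Delta X-XJ)=0$ for all $X\in\mathcal L$, and transitive if $\{Xv:X\in\mathcal L\}=\mathbb C^3$ for every nonzero $v\in\mathbb C^3$. Canonical basis: order pairs $(i,j)$, $i\in\{1,2,3\}$, $j\in\{1,2\}$, lexicographically ($\prec$). Each 2-dimensional subspace $\mathcal L_0\subset\mathcal M_3$ has a unique basis $(L_1,L_2)$, $L_k=[l^k_{i,j}]$, for which there are (unique) pairs $(i_1,j_1)\prec(i_2,j_2)$ with $l^k_{i_r,j_r}=\delta_{k,r}$ for $k,r\in\{1,2\}$ and $l^k_{i,j}=0$ whenever $(i,j)\prec(i_k,j_k)$; it is the canonical basis. Put $\beta_1=b_\Delta(1)=\frac1{b_3}-\frac1{b_2}$, $\beta_2=b_\Delta(2)=\frac1{b_3}-\frac1{b_1}$,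 $\beta_3=b_\Delta(3)=\frac1{b_2}-\frac1{b_1}$. The forms are (parameters $x,y\in\mathbb C$ arbitrary unless restricted): (E1) $L_1=\begin{bmatrix}1&-1/\beta_3&0\\ 0&0&0\\ \beta_1x&x&0\end{bmatrix}$, $L_2=\begin{bmatrix}0&0&0\\ 0&1&0\\ \beta_1y&y&0\end{bmatrix}$; (E2) $L_1=\begin{bmatrix}1&-1/\beta_2&0\\ -\beta_1x&x&0\\ 0&0&0\end{bmatrix}$, $L_2=\begin{bmatrix}0&0&0\\ 0&0&0\\ 0&1&0\end{bmatrix}$; (E3) $L_1=\begin{bmatrix}0&0&0\\ 1&-1/\beta_1&0\\ 0&0&0\end{bmatrix}$, $L_2=\begin{bmatrix}0&0&0\\ 0&0&0\\ 0&1&0\end{bmatrix}$; (E4) $L_1=\begin{bmatrix}0&1&0\\ 0&0&0\\ \beta_2x&x&0\end{bmatrix}$, $L_2=\begin{bmatrix}0&0&0\\ 1&1/\beta_3&0\\ \beta_2y&y&0\end{bmatrix}$; (E5) $L_1=\begin{bmatrix}0&1&0\\ \beta_3x&x&0\\ 0&0&0\end{bmatrix}$, $L_2=\begin{bmatrix}0&0&0\\ 0&0&0\\ 1&1/\beta_2&0\end{bmatrix}$; (E6) $L_1=\begin{bmatrix}0&0&0\\ 0&1&0\\ 0&0&0\end{bmatrix}$, $L_2=\begin{bmatrix}0&0&0\\ 0&0&0\\ 1&1/\beta_1&0\end{bmatrix}$; (E8) $L_1=\begin{bmatrix}0&0&0\\ 1&0&0\\ x&0&0\end{bmatrix}$,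 $L_2=\begin{bmatrix}0&0&0\\ 0&1&0\\ \beta_1x&x&0\end{bmatrix}$; (E9) $L_1=\begin{bmatrix}0&0&0\\ 0&0&0\\ 1&0&0\end{bmatrix}$, $L_2=\begin{bmatrix}0&0&0\\ 0&0&0\\ 0&1&0\end{bmatrix}$; (E10) $L_1=\begin{bmatrix}1&0&0\\ 0&0&0\\ x&0&0\end{bmatrix}$, $L_2=\begin{bmatrix}0&0&0\\ 1&0&0\\ y&0&0\end{bmatrix}$; (E11) $L_1=\begin{bmatrix}1&u&0\\ 0&0&0\\ (1+\beta_2u)x/u&x&0\end{bmatrix}$, $L_2=\begin{bmatrix}0&0&0\\ 1&u/(1+\beta_3u)&0\\ (1+\beta_2u)y/u&y&0\end{bmatrix}$, $u\in\mathbb C\setminus\{0,-1/\beta_3\}$; (E12) $L_1=\begin{bmatrix}1&0&0\\ x&0&0\\ 0&0&0\end{bmatrix}$, $L_2=\begin{bmatrix}0&0&0\\ 0&0&0\\ 1&0&0\end{bmatrix}$; (E13) $L_1=\begin{bmatrix}1&u&0\\ (1+\beta_3u)x/u&x&0\\ 0&0&0\end{bmatrix}$, $L_2=\begin{bmatrix}0&0&0\\ 0&0&0\\ 1&u/(1+\beta_2u)&0\end{bmatrix}$, $u\in\mathbb C\setminus\{0,-1/\beta_3,-1/\beta_2\}$; (E14) $L_1=\begin{bmatrix}0&0&0\\ 1&x&0\\ 0&0&0\end{bmatrix}$, $L_2=\begin{bmatrix}0&0&0\\ 0&0&0\\ 1&x/(1+\beta_1x)&0\end{bmatrix}$, $x\in\mathbb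 C\setminus\{-1/\beta_1\}$. *)

theory Defs
  imports "HOL-Analysis.Analysis"
begin

type_synonym cmat3 = "complex^3^3"

text \<open>
  The library operation \<open>*s\<close> on \<^typ>\<open>complex^3^3\<close> takes its scalars from \<^typ>\<open>complex^3\<close>, and the
  class-based \<open>subspace\<close> and \<open>dim\<close> are over the reals.  The interpretation below
  provides \<open>cmat.subspace\<close>, \<open>cmat.span\<close>, \<open>cmat.dim\<close>, etc.\ over the complex numbers.
\<close>

definition cscale :: "complex \<Rightarrow> cmat3 \<Rightarrow> cmat3" where
  "cscale c A = (\<chi> i j. c * A $ i $ j)"

global_interpretation cmat: vector_space cscale
  by unfold_locales (simp_all add: cscale_def vec_eq_iff algebra_simps)

definition third_column_zero :: "cmat3 set" where
  "third_column_zero = {X. \<forall>i. X $ i $ 3 = 0}"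

definition J :: cmat3 where
  "J = vector [vector [0, 0, 0],
               vector [1, 0, 0],
               vector [0, 1, 0]]"

definition diag :: "complex^3 \<Rightarrow> cmat3" where
  "diag b = (\<chi> i j. if i = j then b $ i else 0)"

definition singular_wrt :: "cmat3 \<Rightarrow> cmat3 set \<Rightarrow> bool" where
  "singular_wrt \<Delta> \<L> \<longleftrightarrow> (\<forall>X\<in>\<L>. det (\<Delta> ** X - X ** J) = 0)"

definition transitive :: "cmat3 set \<Rightarrow> bool" where
  "transitive \<L> \<longleftrightarrow> (\<forall>v::complex^3. v \<noteq> 0 \<longrightarrow> {X *v v | X. X \<in> \<L>} = UNIV)"

text \<open>
  Positions are pairs of natural numbers: in the index type \<^typ>\<open>3\<close> the numeral
  \<open>3\<close> equals \<open>0\<close>, so its built-in order is \<open>3 < 1 < 2\<close>.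
\<close>

definition entry :: "cmat3 \<Rightarrow> nat \<times> nat \<Rightarrow> complex" where
  "entry A p = A $ of_nat (fst p) $ of_nat (snd p)"

definition positions :: "(nat \<times> nat) set" where
  "positions = {1..3} \<times> {1..2}"

definition lex_less :: "nat \<times> nat \<Rightarrow> nat \<times> nat \<Rightarrow> bool" (infix \<open>\<prec>\<close> 50) where
  "p \<prec> q \<longleftrightarrow> fst p < fst q \<or> (fst p = fst q \<and> snd p < snd q)"

definition canonical_basis :: "cmat3 set \<Rightarrow> cmat3 \<Rightarrow> cmat3 \<Rightarrow> bool" where
  "canonical_basis \<L>\<^sub>0 L\<^sub>1 L\<^sub>2 \<longleftrightarrow>
     L\<^sub>1 \<noteq> L\<^sub>2 \<and> cmat.independent {L\<^sub>1, L\<^sub>2} \<and> cmat.span {L\<^sub>1, L\<^sub>2} = \<L>\<^sub>0 \<and>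
     (\<exists>p\<^sub>1\<in>positions. \<exists>p\<^sub>2\<in>positions. p\<^sub>1 \<prec> p\<^sub>2 \<and>
        entry L\<^sub>1 p\<^sub>1 = 1 \<and> entry L\<^sub>1 p\<^sub>2 = 0 \<and>
        entry L\<^sub>2 p\<^sub>1 = 0 \<and> entry L\<^sub>2 p\<^sub>2 = 1 \<and>
        (\<forall>p\<in>positions. p \<prec> p\<^sub>1 \<longrightarrow> entry L\<^sub>1 p = 0) \<and>
        (\<forall>p\<in>positions. p \<prec> p\<^sub>2 \<longrightarrow> entry L\<^sub>2 p = 0))"

definition \<beta>\<^sub>1 :: "complex^3 \<Rightarrow> complex" where "\<beta>\<^sub>1 b = 1 / b $ 3 - 1 / b $ 2"
definition \<beta>\<^sub>2 :: "complex^3 \<Rightarrow> complex" where "\<beta>\<^sub>2 b = 1 / b $ 3 - 1 / b $ 1"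
definition \<beta>\<^sub>3 :: "complex^3 \<Rightarrow> complex" where "\<beta>\<^sub>3 b = 1 / b $ 2 - 1 / b $ 1"

text \<open>
  \<open>E_form b n L\<^sub>1 L\<^sub>2\<close>: the pair \<open>(L\<^sub>1, L\<^sub>2)\<close> is of the form (E\<open>n\<close>).  There is
  deliberately no rule for \<open>n = 7\<close>.
\<close>

inductive E_form :: "complex^3 \<Rightarrow> nat \<Rightarrow> cmat3 \<Rightarrow> cmat3 \<Rightarrow> bool" for b where
  E1: "E_form b 1
    (vector [vector [1, - 1 / \<beta>\<^sub>3 b, 0],
             vector [0, 0, 0],
             vector [\<beta>\<^sub>1 b * x, x, 0]])
    (vector [vector [0, 0, 0],
             vector [0, 1, 0],
             vector [\<beta>\<^sub>1 b * y, y, 0]])"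
| E2: "E_form b 2
    (vector [vector [1, - 1 / \<beta>\<^sub>2 b, 0],
             vector [- \<beta>\<^sub>1 b * x, x, 0],
             vector [0, 0, 0]])
    (vector [vector [0, 0, 0],
             vector [0, 0, 0],
             vector [0, 1, 0]])"
| E3: "E_form b 3
    (vector [vector [0, 0, 0],
             vector [1, - 1 / \<beta>\<^sub>1 b, 0],
             vector [0, 0, 0]])
    (vector [vector [0, 0, 0],
             vector [0, 0, 0],
             vector [0, 1, 0]])"
| E4: "E_form b 4
    (vector [vector [0, 1, 0],
             vector [0, 0, 0],
             vector [\<beta>\<^sub>2 b * x, x, 0]])
    (vector [vector [0, 0, 0],
             vector [1, 1 / \<beta>\<^sub>3 b, 0],
             vector [\<beta>\<^sub>2 b * y, y, 0]])"
| E5: "E_form b 5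
    (vector [vector [0, 1, 0],
             vector [\<beta>\<^sub>3 b * x, x, 0],
             vector [0, 0, 0]])
    (vector [vector [0, 0, 0],
             vector [0, 0, 0],
             vector [1, 1 / \<beta>\<^sub>2 b, 0]])"
| E6: "E_form b 6
    (vector [vector [0, 0, 0],
             vector [0, 1, 0],
             vector [0, 0, 0]])
    (vector [vector [0, 0, 0],
             vector [0, 0, 0],
             vector [1, 1 / \<beta>\<^sub>1 b, 0]])"
| E8: "E_form b 8
    (vector [vector [0, 0, 0],
             vector [1, 0, 0],
             vector [x, 0, 0]])
    (vector [vector [0, 0, 0],
             vector [0, 1, 0],
             vector [\<beta>\<^sub>1 b * x, x, 0]])"
| E9: "E_form b 9
    (vector [vector [0, 0, 0],
             vector [0, 0, 0],
             vector [1, 0, 0]])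
    (vector [vector [0, 0, 0],
             vector [0, 0, 0],
             vector [0, 1, 0]])"
| E10: "E_form b 10
    (vector [vector [1, 0, 0],
             vector [0, 0, 0],
             vector [x, 0, 0]])
    (vector [vector [0, 0, 0],
             vector [1, 0, 0],
             vector [y, 0, 0]])"
| E11: "u \<notin> {0, - 1 / \<beta>\<^sub>3 b} \<Longrightarrow> E_form b 11
    (vector [vector [1, u, 0],
             vector [0, 0, 0],
             vector [(1 + \<beta>\<^sub>2 b * u) * x / u, x, 0]])
    (vector [vector [0, 0, 0],
             vector [1, u / (1 + \<beta>\<^sub>3 b * u), 0],
             vector [(1 + \<beta>\<^sub>2 b * u) * y / u, y, 0]])"
| E12: "E_form b 12
    (vector [vector [1, 0, 0],
             vector [x, 0, 0],
             vector [0, 0, 0]])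
    (vector [vector [0, 0, 0],
             vector [0, 0, 0],
             vector [1, 0, 0]])"
| E13: "u \<notin> {0, - 1 / \<beta>\<^sub>3 b, - 1 / \<beta>\<^sub>2 b} \<Longrightarrow> E_form b 13
    (vector [vector [1, u, 0],
             vector [(1 + \<beta>\<^sub>3 b * u) * x / u, x, 0],
             vector [0, 0, 0]])
    (vector [vector [0, 0, 0],
             vector [0, 0, 0],
             vector [1, u / (1 + \<beta>\<^sub>2 b * u), 0]])"
| E14: "x \<noteq> - 1 / \<beta>\<^sub>1 b \<Longrightarrow> E_form b 14
    (vector [vector [0, 0, 0],
             vector [1, x, 0],
             vector [0, 0, 0]])
    (vector [vector [0, 0, 0],
             vector [0, 0, 0],
             vector [1, x / (1 + \<beta>\<^sub>1 b * x), 0]])"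

end

theory Submission
  imports Defs
begin

text \<open>
  In every listed form \<open>L\<^sub>2\<close> is a nonzero matrix whose first row vanishes, and this suffices.
  The columns of \<open>\<Delta>X - XJ\<close> are \<open>\<Delta>c\<^sub>1 - c\<^sub>2\<close>, \<open>\<Delta>c\<^sub>2 - c\<^sub>3\<close>, \<open>\<Delta>c\<^sub>3\<close>, and its determinant vanishes at
  \<open>X + t L\<^sub>2\<close> for all \<open>X \<in> \<L>\<close> and all \<open>t\<close>.  The coefficient of \<open>t\<^sup>2\<close> shows that the first two columns
  of \<open>\<Delta>L\<^sub>2 - L\<^sub>2J\<close> are \<open>\<lambda>z\<close> and \<open>\<mu>z\<close> for some \<open>z \<noteq> 0\<close> with \<open>z\<^sub>1 = 0\<close>.  The coefficient of \<open>t\<close> then shows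
  that \<open>\<lambda>(\<Delta>c\<^sub>2 - c\<^sub>3) - \<mu>(\<Delta>c\<^sub>1 - c\<^sub>2)\<close>, \<open>\<Delta>c\<^sub>3\<close> and \<open>z\<close> are always dependent.  If \<open>\<L>\<close> is transitive, \<open>c\<^sub>3\<close> is
  arbitrary, and it follows that the first entries of the first two of these vectors are
  proportional on \<open>\<L>\<close>.  This is a linear relation between the entries of the first row of \<open>X\<close>, so
  the first entry of \<open>Xv\<close> vanishes on \<open>\<L>\<close> for some \<open>v \<noteq> 0\<close>.
\<close>

lemma det_diag_minus_J:
  "det (diag b ** X - X ** J) =
    (b$1 * X$1$1 - X$1$2) * ((b$2 * X$2$2 - X$2$3) * (b$3 * X$3$3) - (b$3 * X$3$2 - X$3$3) * (b$2 * X$2$3))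
  - (b$1 * X$1$2 - X$1$3) * ((b$2 * X$2$1 - X$2$2) * (b$3 * X$3$3) - (b$3 * X$3$1 - X$3$2) * (b$2 * X$2$3))
  + b$1 * X$1$3 * ((b$2 * X$2$1 - X$2$2) * (b$3 * X$3$2 - X$3$3) - (b$3 * X$3$1 - X$3$2) * (b$2 * X$2$2 - X$2$3))"
  by (simp add: det_3 matrix_matrix_mult_def sum_3 J_def diag_def vector_3) (simp add: algebra_simps)

lemma quadratic_coeffs_eq_zero:
  fixes c0 c1 c2 :: complex
  assumes "\<And>t. c0 + c1 * t + c2 * t\<^sup>2 = 0"
  shows "c1 = 0" "c2 = 0"
proof -
  have "c0 = 0" "c0 + c1 + c2 = 0" "c0 - c1 + c2 = 0"
    using assms[of 0] assms[of 1] assms[of "-1"] by simp_all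
  then show "c1 = 0" "c2 = 0" by algebra+
qed

text \<open>A nonzero 2x2 matrix of determinant zero has rank one, so it is an outer
  product.\<close>

lemma parallel_pairs:
  fixes p q h k :: "'a::field"
  assumes "p * k = q * h" and "p \<noteq> 0 \<or> q \<noteq> 0 \<or> h \<noteq> 0 \<or> k \<noteq> 0"
  obtains l m y z where "p = l * y" "q = l * z" "h = m * y" "k = m * z"
    "l \<noteq> 0 \<or> m \<noteq> 0" "y \<noteq> 0 \<or> z \<noteq> 0"
proof (cases "p = 0 \<and> q = 0")
  case True
  with assms(2) show ?thesis by (intro that[where l = 0 and m = 1 and y = h and z = k]) auto
next
  case False
  show ?thesis
  proof (cases "p = 0")
    case True
    with False assms(1) show ?thesis by (intro that[where l = 1 and m = "k / q" and y = p and z = q]) auto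
  next
    case p: False
    with assms(1) show ?thesis by (intro that[where l = 1 and m = "h / p" and y = p and z = q]) (auto simp: field_simps)
  qed
qed

text \<open>\<open>F\<close> vanishes on the kernel of \<open>f\<close>: there
  \<open>F * g = 0\<close>, and where \<open>g\<close> vanishes, shifting by \<open>X0\<close> makes
  it nonzero.\<close>

lemma proportional_functionals:
  fixes F G f g :: "cmat3 \<Rightarrow> complex"
  assumes \<L>: "cmat.subspace \<L>"
    and F: "\<And>X Y. F (X + Y) = F X + F Y" "\<And>c X. F (cscale c X) = c * F X"
    and f: "\<And>X Y. f (X + Y) = f X + f Y" "\<And>c X. f (cscale c X) = c * f X"
    and g: "\<And>X Y. g (X + Y) = g X + g Y"
    and eq: "\<And>X. X \<in> \<L> \<Longrightarrow> F X * g X = f X * G X"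
    and X0: "X0 \<in> \<L>" "f X0 = 0" "g X0 \<noteq> 0"
    and X1: "X1 \<in> \<L>" "f X1 = 1"
    and X: "X \<in> \<L>"
  shows "F X = F X1 * f X"
proof -
  have F_zero: "F Y = 0" if Y: "Y \<in> \<L>" "f Y = 0" for Y
  proof (cases "g Y = 0")
    case False
    with eq[OF Y(1)] Y(2) show ?thesis by simp
  next
    case True
    have "F X0 = 0" using eq[OF X0(1)] X0 by simp
    moreover have "F (Y + X0) = 0"
      using eq[OF cmat.subspace_add[OF \<L> Y(1) X0(1)]] True Y(2) X0 by (simp add: f g)
    ultimately show ?thesis by (simp add: F)
  qed
  have "X + cscale (- f X) X1 \<in> \<L>"
    by (intro cmat.subspace_add cmat.subspace_scale \<L> X X1(1))
  then have "F (X + cscale (- f X) X1) = 0"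
    by (rule F_zero) (simp only: f X1(2), simp)
  then have "F X + - f X * F X1 = 0" by (simp only: F)
  then show ?thesis by (simp add: mult.commute)
qed

lemma not_transitive_if_first_row_zero:
  fixes b :: "complex^3" and L :: cmat3
  assumes b: "b$1 \<noteq> 0" "b$2 \<noteq> 0" "b$3 \<noteq> 0"
    and \<L>: "cmat.subspace \<L>" and sing: "singular_wrt (diag b) \<L>"
    and L: "L \<in> \<L>" "L \<in> third_column_zero" "L$1 = 0" "L \<noteq> 0"
  shows "\<not> transitive \<L>"
proof
  assume trans: "transitive \<L>"
  have third_column: "\<exists>X\<in>\<L>. X$1$3 = w1 \<and> X$2$3 = w2 \<and> X$3$3 = w3" for w1 w2 w3
  proof -
    have "(axis 3 1 :: complex^3) \<noteq> 0" by simp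
    then have "(vector [w1, w2, w3] :: complex^3) \<in> {X *v axis 3 1 | X. X \<in> \<L>}"
      using trans unfolding transitive_def by blast
    then obtain X where "X \<in> \<L>" "vector [w1, w2, w3] = X *v axis 3 1" by blast
    then show ?thesis
      by (intro bexI[of _ X])
        (auto simp: vec_eq_iff forall_3 matrix_vector_mult_def sum_3 axis_def vector_3)
  qed
  \<comment> \<open>\<open>B i\<close>, \<open>A i\<close>, \<open>W i\<close> form row
    \<open>i\<close> of \<open>diag b ** X - X ** J\<close>, in this order.\<close>
  define A B W where "A = (\<lambda>i (X::cmat3). b$i * X$i$2 - X$i$3)"
    and "B = (\<lambda>i (X::cmat3). b$i * X$i$1 - X$i$2)" and "W = (\<lambda>i (X::cmat3). b$i * X$i$3)"
  note defs = A_def B_def W_def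
  have L0: "L$1$1 = 0" "L$1$2 = 0" "L$1$3 = 0" "L$2$3 = 0" "L$3$3 = 0"
    using L by (auto simp: third_column_zero_def)
  have coeffs:
    "B 1 X * (A 2 L * W 3 X - A 3 L * W 2 X) - A 1 X * (B 2 L * W 3 X - B 3 L * W 2 X)
      + W 1 X * (B 2 L * A 3 X - B 3 L * A 2 X + B 2 X * A 3 L - B 3 X * A 2 L) = 0"
    "W 1 X * (B 2 L * A 3 L - B 3 L * A 2 L) = 0" if X: "X \<in> \<L>" for X
  proof -
    \<comment> \<open>No cubic term: the first row and third column of
      \<open>diag b ** L - L ** J\<close> vanish.\<close>
    have "det (diag b ** X - X ** J)
      + (B 1 X * (A 2 L * W 3 X - A 3 L * W 2 X) - A 1 X * (B 2 L * W 3 X - B 3 L * W 2 X)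
      + W 1 X * (B 2 L * A 3 X - B 3 L * A 2 X + B 2 X * A 3 L - B 3 X * A 2 L)) * t
      + W 1 X * (B 2 L * A 3 L - B 3 L * A 2 L) * t\<^sup>2 = 0" for t
    proof -
      have "det (diag b ** (X + cscale t L) - (X + cscale t L) ** J) = 0"
        using sing \<L> X L(1) by (simp add: singular_wrt_def cmat.subspace_add cmat.subspace_scale)
      then show ?thesis
        unfolding det_diag_minus_J defs by (simp add: cscale_def L0) algebra
    qed
    from quadratic_coeffs_eq_zero[OF this] show
      "B 1 X * (A 2 L * W 3 X - A 3 L * W 2 X) - A 1 X * (B 2 L * W 3 X - B 3 L * W 2 X)
      + W 1 X * (B 2 L * A 3 X - B 3 L * A 2 X + B 2 X * A 3 L - B 3 X * A 2 L) = 0"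
      "W 1 X * (B 2 L * A 3 L - B 3 L * A 2 L) = 0" by blast+
  qed
  obtain X1 where X1: "X1 \<in> \<L>" "W 1 X1 = 1"
    using third_column[of "1 / b$1" 0 0] b by (auto simp: W_def)
  have "B 2 L * A 3 L = B 3 L * A 2 L" using coeffs(2)[OF X1(1)] X1(2) by simp
  moreover have "B 2 L \<noteq> 0 \<or> B 3 L \<noteq> 0 \<or> A 2 L \<noteq> 0 \<or> A 3 L \<noteq> 0"
  proof (rule ccontr)
    assume "\<not> ?thesis"
    then have "L$2$2 = 0" "L$3$2 = 0" "L$2$1 = 0" "L$3$1 = 0"
      using b L0 by (auto simp: A_def B_def)
    then have "L = 0" using L0 by (simp add: vec_eq_iff forall_3)
    with L(4) show False ..
  qed
  ultimately obtain l m y z where lmyz: "B 2 L = l * y" "B 3 L = l * z" "A 2 L = m * y" "A 3 L = m * z"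
    and lm: "l \<noteq> 0 \<or> m \<noteq> 0" and yz: "y \<noteq> 0 \<or> z \<noteq> 0"
    by (rule parallel_pairs)
  \<comment> \<open>The third column of \<open>X0\<close> is chosen so that
    \<open>(W 2 X0, W 3 X0)\<close> is not a multiple of \<open>(y, z)\<close>.\<close>
  obtain X0 where X0: "X0 \<in> \<L>" "W 1 X0 = 0" "z * W 2 X0 - y * W 3 X0 \<noteq> 0"
  proof (cases "z = 0")
    case True
    with yz that b show ?thesis using third_column[of 0 0 1] by (auto simp: W_def)
  next
    case False
    with that b show ?thesis using third_column[of 0 1 0] by (auto simp: W_def)
  qed
  define F where "F = (\<lambda>X. l * A 1 X - m * B 1 X)"
  have F: "F X = F X1 * W 1 X" if "X \<in> \<L>" for X
  proof (rule proportional_functionals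
      [where f = "W 1" and g = "\<lambda>X. z * W 2 X - y * W 3 X", OF \<L> _ _ _ _ _ _ X0 X1 that])
    \<comment> \<open>This is the vanishing determinant with columns \<open>l * A - m * B\<close>,
      \<open>W\<close> and \<open>(0, y, z)\<close>, expanded along its first row.\<close>
    show "F X * (z * W 2 X - y * W 3 X) =
        W 1 X * (z * (l * A 2 X - m * B 2 X) - y * (l * A 3 X - m * B 3 X))" if "X \<in> \<L>" for X
      using coeffs(1)[OF that] unfolding lmyz F_def by algebra
  qed (simp_all add: F_def defs cscale_def algebra_simps)
  \<comment> \<open>The entries are the coefficients of row 1 of \<open>X\<close> in
    \<open>F X - F X1 * W 1 X\<close>.\<close>
  define v :: "complex^3" where
    "v = vector [- m * b$1, l * b$1 + m, - l - F X1 * b$1]"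
  have "v \<noteq> 0" using lm b by (auto simp: v_def vec_eq_iff forall_3 vector_3)
  then have "axis 1 1 \<in> {X *v v | X. X \<in> \<L>}"
    using trans unfolding transitive_def by blast
  then obtain X where X: "X \<in> \<L>" "X *v v = axis 1 1" by auto
  have "(X *v v) $ 1 = F X - F X1 * W 1 X"
    by (simp add: matrix_vector_mult_def sum_3 v_def vector_3 F_def defs algebra_simps)
  with F[OF X(1)] X(2) show False by (simp add: axis_def)
qed

theorem theorem37:
  fixes b :: "complex^3" and \<L> :: "cmat3 set" and L\<^sub>1 L\<^sub>2 :: cmat3 and n :: nat
  assumes "b $ 1 \<noteq> 0" "b $ 2 \<noteq> 0" "b $ 3 \<noteq> 0"
    and "b $ 1 \<noteq> b $ 2" "b $ 1 \<noteq> b $ 3" "b $ 2 \<noteq> b $ 3"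
    and "cmat.subspace \<L>" and "cmat.dim \<L> = 5"
    and "cmat.dim (\<L> \<inter> third_column_zero) = 2"
    and "canonical_basis (\<L> \<inter> third_column_zero) L\<^sub>1 L\<^sub>2"
    and "n \<in> {1..14}" and "n \<noteq> 7" and "E_form b n L\<^sub>1 L\<^sub>2"
    and "singular_wrt (diag b) \<L>"
  shows "\<not> transitive \<L>"
proof -
  have indep: "cmat.independent {L\<^sub>1, L\<^sub>2}" and span: "cmat.span {L\<^sub>1, L\<^sub>2} = \<L> \<inter> third_column_zero"
    using assms(10) by (auto simp: canonical_basis_def)
  have "L\<^sub>2 \<in> \<L> \<inter> third_column_zero"
    unfolding span[symmetric] by (simp add: cmat.span_base)
  moreover have "L\<^sub>2 \<noteq> 0" using indep cmat.dependent_zero by blast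
  moreover have "L\<^sub>2 $ 1 = 0"
    using assms(13) by cases (simp_all add: vector_3 vec_eq_iff forall_3)
  ultimately show ?thesis
    using not_transitive_if_first_row_zero assms(1-3,7,14) by blast
qed

end
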